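(* Let $t$ be any of the functions $\mathrm{ReLU}$, $\mathrm{softplus}$, $\mathrm{smoothReLU}_a$ (with parameter $a>0$), $\mathrm{ELU}$. Then the function $t'(x)=t(1-t(-x))$ satisfies the following: there are reals $\alpha<\beta$ such that $\lim_{x\to-\infty}t'(x)=\alpha$, $\lim_{x\to\infty}t'(x)=\beta$, and $t'(x)\le t'(y)$ for all $x<y$. Therefore $\mathrm{ReLU}$, $\mathrm{softplus}$, $\mathrm{smoothReLU}_a$ and $\mathrm{ELU}$ are squashable.
   Context: $\mathrm{ReLU}(x)=x$ if $x\ge0$ and $0$ if $x<0$. $\mathrm{ELU}(x)=x$ if $x\ge 0$ and $e^x-1$ if $x<0$. $\mathrm{softplus}(x)=\log(1+e^x)$. For $a>0$, $\mathrm{smoothReLU}_a(x)=x-\frac1a\log(ax+1)$ if $x\ge0$ and $0$ if $x<0$. A function $t:\mathbb{R}\to\mathbb{R}$ is squashable iff either (1) there are reals $\alpha<\beta$ with $\lim_{x\to-\infty}t(x)=\alpha$, $\lim_{x\to\infty}t(x)=\beta$ and $t(x)\le t(y)$ for all $x<y$; or (2) some function $t':\mathbb{R}\to\mathbb{R}$ satisfying the condition in (1) can be expressed, in one variable $x$, by the grammar $N ::= c \mid x \mid N_1+N_2 \mid c*N_1 \mid t(N_1)$ with $c\in\mathbb{R}$. *)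

theory Defs
  imports Complex_Main
begin

definition ReLU :: "real \<Rightarrow> real" where
  "ReLU x = (if x \<ge> 0 then x else 0)"

definition ELU :: "real \<Rightarrow> real" where
  "ELU x = (if x \<ge> 0 then x else exp x - 1)"

definition softplus :: "real \<Rightarrow> real" where
  "softplus x = ln (1 + exp x)"

text \<open>The parameter \<open>a\<close> is meant to be positive; this is assumed where the function is used.\<close>

definition smoothReLU :: "real \<Rightarrow> real \<Rightarrow> real" where
  "smoothReLU a x = (if x \<ge> 0 then x - (1 / a) * ln (a * x + 1) else 0)"

definition squashing :: "(real \<Rightarrow> real) \<Rightarrow> bool" where
  "squashing t \<longleftrightarrow>
     (\<exists>\<alpha> \<beta>. \<alpha> < \<beta> \<and> (t \<longlongrightarrow> \<alpha>) at_bot \<and> (t \<longlongrightarrow> \<beta>) at_top \<and>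
       (\<forall>x y. x < y \<longrightarrow> t x \<le> t y))"

text \<open>
  The grammar \<open>N ::= c | x | N\<^sub>1 + N\<^sub>2 | c * N\<^sub>1 | t(N\<^sub>1)\<close> in the single variable \<open>x\<close>.
  The activation function \<open>t\<close> is an uninterpreted unary symbol \<open>Act\<close> in the syntax and is
  supplied to the evaluation function.
\<close>

datatype net = Const real | Var | Add net net | Scale real net | Act net

primrec eval_net :: "(real \<Rightarrow> real) \<Rightarrow> net \<Rightarrow> real \<Rightarrow> real" where
  "eval_net t (Const c) x = c"
| "eval_net t Var x = x"
| "eval_net t (Add N M) x = eval_net t N x + eval_net t M x"
| "eval_net t (Scale c N) x = c * eval_net t N x"
| "eval_net t (Act N) x = t (eval_net t N x)"

definition expressible :: "(real \<Rightarrow> real) \<Rightarrow> (real \<Rightarrow> real) \<Rightarrow> bool" where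
  "expressible t f \<longleftrightarrow> (\<exists>N. \<forall>x. f x = eval_net t N x)"

definition squashable :: "(real \<Rightarrow> real) \<Rightarrow> bool" where
  "squashable t \<longleftrightarrow> squashing t \<or> (\<exists>t'. squashing t' \<and> expressible t t')"

end

theory Submission
  imports Defs "HOL-Real_Asymp.Real_Asymp"
begin

text \<open>
  Each of the four functions is monotone, tends to \<open>\<infinity>\<close> at \<open>\<infinity>\<close> and to a finite limit \<open>p\<close> at
  \<open>-\<infinity>\<close>, and is continuous at \<open>1 - p\<close> with \<open>p < t (1 - p)\<close>. Hence \<open>t (1 - t (- x))\<close> is a
  composition of two order-reversing maps, with limits \<open>p\<close> and \<open>t (1 - p)\<close>.
\<close>

lemma squashing_reflected_comp:
  fixes t :: "real \<Rightarrow> real"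
  assumes "mono t" and top: "filterlim t at_top at_top" and bot: "(t \<longlongrightarrow> p) at_bot"
    and cont: "isCont t (1 - p)" and "p < t (1 - p)"
  shows "squashing (\<lambda>x. t (1 - t (- x)))"
  unfolding squashing_def
proof (intro exI conjI allI impI)
  show "p < t (1 - p)" by fact
  have "filterlim (\<lambda>x. t (- x)) at_top at_bot"
    by (rule filterlim_compose[OF top filterlim_uminus_at_top_at_bot])
  \<comment> \<open>The constant -1 comes from negating: \<open>- (1 - t (- x))\<close> is
    \<open>-1 + t (- x)\<close>, which tends to infinity.\<close>
  then have "filterlim (\<lambda>x. 1 - t (- x)) at_bot at_bot"
    using filterlim_tendsto_add_at_top[OF tendsto_const[of "-1"]]
    by (fastforce simp: filterlim_uminus_at_bot)
  then show "((\<lambda>x. t (1 - t (- x))) \<longlongrightarrow> p) at_bot"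
    by (rule filterlim_compose[OF bot])
  have "((\<lambda>x. t (- x)) \<longlongrightarrow> p) at_top"
    by (rule filterlim_compose[OF bot filterlim_uminus_at_bot_at_top])
  then show "((\<lambda>x. t (1 - t (- x))) \<longlongrightarrow> t (1 - p)) at_top"
    by (intro isCont_tendsto_compose[OF cont] tendsto_intros)
next
  fix x y :: real
  assume "x < y"
  then show "t (1 - t (- x)) \<le> t (1 - t (- y))"
    using \<open>mono t\<close> by (simp add: monoD)
qed

lemma expressible_reflected_comp: "expressible t (\<lambda>x. t (1 - t (- x)))"
  unfolding expressible_def
  \<comment> \<open>The grammar has neither subtraction nor negation; both are written as scaling by
    -1.\<close>
  by (rule exI[of _ "Act (Add (Const 1) (Scale (- 1) (Act (Scale (- 1) Var))))"]) simp

text \<open>Continuity is local and the positive half-line is an open neighbourhood of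
  \<open>c\<close>. This lets one branch of a piecewise definition stand in for the whole function;
  the next two lemmas do the same for limits at either infinity.\<close>

lemma isCont_eq_on_pos:
  fixes f g :: "real \<Rightarrow> real"
  assumes "isCont g c" "c > 0" "\<And>x. x > 0 \<Longrightarrow> f x = g x"
  shows "isCont f c"
proof -
  have "\<forall>\<^sub>F x in nhds c. f x = g x"
    using eventually_nhds_in_open[of "{0<..}" c] assms by (auto elim: eventually_mono)
  then show ?thesis
    using assms(1) isCont_cong by blast
qed

lemma filterlim_at_top_eq_on_pos:
  fixes f g :: "real \<Rightarrow> real"
  assumes "filterlim g F at_top" "\<And>x. x > 0 \<Longrightarrow> f x = g x"
  shows "filterlim f F at_top"
proof -
  have "\<forall>\<^sub>F x in at_top. f x = g x"
    using eventually_gt_at_top[of 0] by eventually_elim (rule assms(2))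
  then show ?thesis
    using assms(1) filterlim_cong[OF refl refl] by blast
qed

lemma filterlim_at_bot_eq_on_neg:
  fixes f g :: "real \<Rightarrow> real"
  assumes "filterlim g F at_bot" "\<And>x. x < 0 \<Longrightarrow> f x = g x"
  shows "filterlim f F at_bot"
proof -
  have "\<forall>\<^sub>F x in at_bot. f x = g x"
    using eventually_gt_at_bot[of 0] by eventually_elim (rule assms(2))
  then show ?thesis
    using assms(1) filterlim_cong[OF refl refl] by blast
qed

lemma squashing_ReLU_comp: "squashing (\<lambda>x. ReLU (1 - ReLU (- x)))"
proof (rule squashing_reflected_comp[where p = 0])
  show "mono ReLU" by (auto simp: mono_def ReLU_def)
  show "filterlim ReLU at_top at_top"
    by (rule filterlim_at_top_eq_on_pos[OF filterlim_ident]) (simp add: ReLU_def)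
  show "(ReLU \<longlongrightarrow> 0) at_bot"
    by (rule filterlim_at_bot_eq_on_neg[OF tendsto_const]) (simp add: ReLU_def)
  show "isCont ReLU (1 - 0)"
    by (rule isCont_eq_on_pos[where g = "\<lambda>x. x"]) (auto simp: ReLU_def)
qed (simp add: ReLU_def)

lemma squashing_softplus_comp: "squashing (\<lambda>x. softplus (1 - softplus (- x)))"
proof (rule squashing_reflected_comp[where p = 0])
  show "mono softplus" by (auto simp: mono_def softplus_def add_pos_pos)
  show "filterlim softplus at_top at_top"
    unfolding softplus_def by real_asymp
  show "(softplus \<longlongrightarrow> 0) at_bot"
    unfolding softplus_def by real_asymp
  show "isCont softplus (1 - 0)"
    unfolding softplus_def by (intro continuous_intros) (simp add: add_pos_pos add_nonneg_eq_0_iff)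
qed (simp add: softplus_def add_pos_pos)

lemma squashing_ELU_comp: "squashing (\<lambda>x. ELU (1 - ELU (- x)))"
\<comment> \<open>\<open>ELU\<close> tends to -1 at minus infinity, so the outer limit point
  \<open>1 - p\<close> is 2, inside the linear branch.\<close>
proof (rule squashing_reflected_comp[where p = "-1"])
  show "mono ELU"
  proof (rule monoI)
    fix x y :: real
    assume "x \<le> y"
    \<comment> \<open>The case across the two branches: 0 separates their values.\<close>
    moreover have "exp x - 1 \<le> y" if "x < 0" "0 \<le> y"
      using that exp_le_one_iff[of x] by linarith
    ultimately show "ELU x \<le> ELU y" by (auto simp: ELU_def)
  qed
  show "filterlim ELU at_top at_top"
    by (rule filterlim_at_top_eq_on_pos[OF filterlim_ident]) (simp add: ELU_def)
  show "(ELU \<longlongrightarrow> -1) at_bot"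
  proof (rule filterlim_at_bot_eq_on_neg)
    show "((\<lambda>x. exp x - 1) \<longlongrightarrow> - (1 :: real)) at_bot"
      by real_asymp
  qed (simp add: ELU_def)
  show "isCont ELU (1 - (-1))"
    by (rule isCont_eq_on_pos[where g = "\<lambda>x. x"]) (auto simp: ELU_def)
qed (simp add: ELU_def)

text \<open>On the nonnegative branch, concavity of \<open>ln\<close> bounds its increment by the
  tangent at \<open>a * x + 1\<close>. Since this point is at least 1, the slope is at most 1, so
  the logarithmic term divided by \<open>a\<close> grows no faster than the identity.\<close>

lemma mono_smoothReLU:
  assumes "a > 0"
  shows "mono (smoothReLU a)"
proof (rule monoI)
  have incr: "x - (1 / a) * ln (a * x + 1) \<le> y - (1 / a) * ln (a * y + 1)"
    if "0 \<le> x" "x \<le> y" for x y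
  proof -
    have le: "a * x \<le> a * y" and pos: "0 \<le> a * x"
      using assms that by simp_all
    have "ln (a * y + 1) - ln (a * x + 1) \<le> ((a * y + 1) - (a * x + 1)) / (a * x + 1)"
      using le pos by (intro ln_diff_le) linarith+
    also have "\<dots> \<le> a * (y - x)"
      using le pos mult_left_mono[of 1 "a * x + 1" "a * (y - x)"]
      by (simp add: divide_le_eq right_diff_distrib)
    finally have "(ln (a * y + 1) - ln (a * x + 1)) / a \<le> y - x"
      using assms by (simp add: pos_divide_le_eq mult.commute)
    then show ?thesis
      by (simp add: diff_divide_distrib)
  qed
  fix x y :: real
  assume "x \<le> y"
  then show "smoothReLU a x \<le> smoothReLU a y"
    \<comment> \<open>The instance at 0 settles \<open>x < 0 \<le> y\<close>: the nonnegative branch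
      vanishes at 0, hence is nonnegative at \<open>y\<close>.\<close>
    using incr[of x y] incr[of 0 y] by (auto simp: smoothReLU_def)
qed

lemma squashing_smoothReLU_comp:
  assumes "a > 0"
  shows "squashing (\<lambda>x. smoothReLU a (1 - smoothReLU a (- x)))"
proof (rule squashing_reflected_comp[where p = 0])
  show "mono (smoothReLU a)" using assms by (rule mono_smoothReLU)
  show "filterlim (smoothReLU a) at_top at_top"
  proof (rule filterlim_at_top_eq_on_pos)
    show "filterlim (\<lambda>x. x - (1 / a) * ln (a * x + 1)) at_top at_top"
      using assms by real_asymp
  qed (simp add: smoothReLU_def)
  show "(smoothReLU a \<longlongrightarrow> 0) at_bot"
    by (rule filterlim_at_bot_eq_on_neg[OF tendsto_const]) (simp add: smoothReLU_def)
  show "isCont (smoothReLU a) (1 - 0)"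
  proof (rule isCont_eq_on_pos)
    show "isCont (\<lambda>x. x - (1 / a) * ln (a * x + 1)) (1 - 0)"
      using assms by (intro continuous_intros) auto
  qed (simp_all add: smoothReLU_def)
  \<comment> \<open>The value is \<open>1 - ln (a + 1) / a\<close>, positive because
    \<open>ln (1 + a) < a\<close>.\<close>
  show "0 < smoothReLU a (1 - 0)"
    using assms ln_add_one_self_less_self[of a] by (simp add: smoothReLU_def add.commute)
qed

theorem proposition2p4:
  fixes a :: real
  assumes "a > 0"
  shows "(\<forall>t \<in> {ReLU, softplus, smoothReLU a, ELU}.
            \<exists>\<alpha> \<beta>. \<alpha> < \<beta> \<and>
              ((\<lambda>x. t (1 - t (- x))) \<longlongrightarrow> \<alpha>) at_bot \<and>
              ((\<lambda>x. t (1 - t (- x))) \<longlongrightarrow> \<beta>) at_top \<and>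
              (\<forall>x y. x < y \<longrightarrow> t (1 - t (- x)) \<le> t (1 - t (- y)))) \<and>
         squashable ReLU \<and> squashable softplus \<and> squashable (smoothReLU a) \<and> squashable ELU"
proof -
  have comp: "squashing (\<lambda>x. t (1 - t (- x)))" if "t \<in> {ReLU, softplus, smoothReLU a, ELU}" for t
    using that squashing_ReLU_comp squashing_softplus_comp squashing_ELU_comp
      squashing_smoothReLU_comp[OF assms] by blast
  \<comment> \<open>All four functions are unbounded above, so squashability comes from the second
    alternative of the definition, with the reflected composition as \<open>t'\<close>.\<close>
  then have "squashable t" if "t \<in> {ReLU, softplus, smoothReLU a, ELU}" for t
    using that expressible_reflected_comp unfolding squashable_def by blast
  then show ?thesis
    using comp unfolding squashing_def by simp
qed

end
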